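(* Suppose $\mu$ is non-atomic. Then for no $s\in(0,1)$ can $(X,T,\mu)$ have the following property: for every $y\in X$ and every nonincreasing sequence of radii $(\rho_n)_{n\in\mathbb{N}}$ with $\sum_n\mu(B(y,\rho_n))^s=\infty$, the sequence $\{B(y,\rho_n)\}$ is a BC sequence for $T$.
   Context: Standing assumptions: $(X,d)$ is a metric space, $\mu$ is a Borel probability measure on $X$, and $T:X\to X$ is measurable and preserves $\mu$, i.e. $\mu(T^{-1}A)=\mu(A)$ for all Borel $A$. $\mathbb{N}=\{1,2,\dots\}$. $B(y,r)=\{x\in X: d(x,y)\le r\}$ is the closed ball of center $y$ and radius $r>0$. Non-atomic means $\mu(\{z\})=0$ for all $z\in X$. BC sequence: a sequence $\{A_n\}_{n\in\mathbb{N}}$ of measurable subsets of $X$ is a Borel-Cantelli (BC) sequence for $T$ if $\mu(\limsup_n T^{-n}A_n)=1$, where $\limsup_n T^{-n}A_n=\{x: T^nx\in A_n\text{ for infinitely many }n\}$.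
   Formalization: It is additionally assumed that μ gives full measure to the closure of some countable set; without this the claim fails if a real-valued measurable cardinal exists (discrete metric, T = identity), and only then can the assumption fail. *)

theory Defs
  imports "HOL-Probability.Probability"
begin

text \<open>
  Sequences are indexed by the positive integers; the value at index \<open>0\<close> is ignored
  (the limes superior of a sequence of sets does not depend on it either).
  Note that \<open>limsup\<close> on sets is the set of points lying in infinitely many members.
\<close>

definition BC_sequence :: "'a measure \<Rightarrow> ('a \<Rightarrow> 'a) \<Rightarrow> (nat \<Rightarrow> 'a set) \<Rightarrow> bool" where
  "BC_sequence M T A \<longleftrightarrow>
     (\<forall>n\<ge>1. A n \<in> sets M) \<and>
     measure M (limsup (\<lambda>n. (T ^^ n) -` A n \<inter> space M)) = 1"

definition measure_preserving_map :: "'a measure \<Rightarrow> ('a \<Rightarrow> 'a) \<Rightarrow> bool" where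
  "measure_preserving_map M T \<longleftrightarrow>
     T \<in> measurable M M \<and>
     (\<forall>A\<in>sets M. measure M (T -` A \<inter> space M) = measure M A)"

text \<open>
  A Borel probability measure carried by a separable closed set. Every Borel probability
  measure on a separable metric space is of this kind, and so is every tight one. A Borel
  probability measure on a metric space that is not of this kind can only exist if there is
  a real-valued measurable cardinal.
\<close>

definition separably_supported :: "'a::metric_space measure \<Rightarrow> bool" where
  "separably_supported M \<longleftrightarrow> (\<exists>D. countable D \<and> measure M (closure D) = 1)"

end

theory Submission
  imports Defs
begin

text \<open>
  Let \<open>y\<close> be a point of the support of the measure. Its balls have positive measures tending
  to \<open>0\<close>, however irregularly. Using each radius for sufficiently many indices, one obtains
  nonincreasing radii for which the sum of the measures converges while the sum of their
  powers with exponent \<open>s < 1\<close> diverges. The convergent half of the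
  Borel--Cantelli lemma then makes the limes superior of the preimages a null set.
\<close>

lemma measure_preserving_map_funpow:
  assumes "measure_preserving_map M T"
  shows "measure_preserving_map M (T ^^ n)"
proof (induction n)
  case 0
  then show ?case
    by (auto simp: measure_preserving_map_def id_def)
next
  case (Suc n)
  have T: "T \<in> measurable M M" and Tn: "T ^^ n \<in> measurable M M"
    using assms Suc by (auto simp: measure_preserving_map_def)
  have "measure M ((T ^^ Suc n) -` A \<inter> space M) = measure M A" if A: "A \<in> sets M" for A
  proof -
    have "(T ^^ Suc n) -` A \<inter> space M = (T ^^ n) -` (T -` A \<inter> space M) \<inter> space M"
      using measurable_space[OF Tn] by auto
    then show ?thesis
      using assms Suc A measurable_sets[OF T A] by (auto simp: measure_preserving_map_def)
  qed
  moreover have "T ^^ Suc n \<in> measurable M M"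
    using T Tn by simp
  ultimately show ?case
    unfolding measure_preserving_map_def by blast
qed

text \<open>If every point had a null ball, the countably many null balls with centre in
  \<open>D\<close> and rational radius would cover \<open>closure D\<close>, a set of measure
  1.\<close>

lemma exists_support_point:
  fixes M :: "'a::metric_space measure"
  assumes "prob_space M" and sets: "sets M = sets borel" and "separably_supported M"
  obtains y where "\<And>r. 0 < r \<Longrightarrow> 0 < measure M (ball y r)"
proof -
  interpret prob_space M by fact
  obtain D where D: "countable D" "measure M (closure D) = 1"
    using assms by (auto simp: separably_supported_def)
  define I where "I = {(d, q). d \<in> D \<and> q \<in> \<rat> \<and> measure M (ball d q) = 0}"
  have "countable I"
    by (rule countable_subset[of _ "D \<times> \<rat>"])
       (auto simp: I_def D countable_rat)
  have "(\<Union>(d, q)\<in>I. ball d q) \<in> null_sets M"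
  proof (rule null_sets_UN'[OF \<open>countable I\<close>], clarify)
    fix d q assume "(d, q) \<in> I"
    then show "ball d q \<in> null_sets M"
      by (auto simp: I_def null_sets_def sets emeasure_eq_measure)
  qed
  then have null: "measure M (\<Union>(d, q)\<in>I. ball d q) = 0"
    by (simp add: measure_eq_0_null_sets)
  have "\<exists>y. \<forall>r>0. 0 < measure M (ball y r)"
  proof (rule ccontr)
    assume "\<nexists>y. \<forall>r>0. 0 < measure M (ball y r)"
    then have none: "\<exists>r>0. measure M (ball y r) = 0" for y
      by (metis zero_less_measure_iff)
    have "closure D \<subseteq> (\<Union>(d, q)\<in>I. ball d q)"
    proof
      fix x assume x: "x \<in> closure D"
      obtain r where r: "r > 0" "measure M (ball x r) = 0"
        using none by blast
      \<comment> \<open>Radii above \<open>r / 3\<close> put \<open>x\<close> into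
        \<open>ball d q\<close>; radii below \<open>2 * r / 3\<close> keep that ball inside
        \<open>ball x r\<close>, so it is null.\<close>
      obtain d where d: "d \<in> D" "dist d x < r / 3"
        using x r by (metis closure_approachable divide_pos_pos zero_less_numeral)
      obtain q where q: "q \<in> \<rat>" "r / 3 < q" "q < 2 * r / 3"
        using Rats_dense_in_real[of "r / 3" "2 * r / 3"] r by auto
      have "ball d q \<subseteq> ball x r"
      proof
        fix z assume "z \<in> ball d q"
        then show "z \<in> ball x r"
          using dist_triangle[of x z d] d q by (simp add: dist_commute)
      qed
      then have "measure M (ball d q) \<le> measure M (ball x r)"
        by (intro finite_measure_mono) (auto simp: sets)
      then have "(d, q) \<in> I"
        using r d q by (auto simp: I_def measure_le_0_iff)
      moreover have "x \<in> ball d q"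
        using d q by simp
      ultimately show "x \<in> (\<Union>(d, q)\<in>I. ball d q)"
        by blast
    qed
    then have "measure M (closure D) \<le> measure M (\<Union>(d, q)\<in>I. ball d q)"
      using \<open>(\<Union>(d, q)\<in>I. ball d q) \<in> null_sets M\<close> by (intro finite_measure_mono) auto
    with null D show False
      by simp
  qed
  then show thesis
    using that by blast
qed

lemma measure_cball_tendsto_singleton:
  fixes M :: "'a::metric_space measure"
  assumes "finite_measure M" and sets: "sets M = sets borel"
  shows "(\<lambda>k. measure M (cball y (1 / Suc k))) \<longlonglongrightarrow> measure M {y}"
proof -
  interpret finite_measure M by fact
  have "(\<lambda>k. measure M (cball y (1 / Suc k))) \<longlonglongrightarrow> measure M (\<Inter>k. cball y (1 / Suc k))"
  proof (rule finite_Lim_measure_decseq)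
    show "range (\<lambda>k. cball y (1 / Suc k)) \<subseteq> sets M"
      by (auto simp: sets)
    show "decseq (\<lambda>k. cball y (1 / Suc k))"
      unfolding decseq_def by (intro allI impI subset_cball) (auto simp: frac_le)
  qed
  moreover have "(\<Inter>k. cball y (1 / Suc k)) = {y}"
  proof -
    have "dist y x = 0" if "\<And>k. dist y x \<le> 1 / Suc k" for x
    proof (rule ccontr)
      assume "dist y x \<noteq> 0"
      then obtain k where "inverse (Suc k) < dist y x"
        using reals_Archimedean[of "dist y x"] by auto
      with that[of k] show False
        by (simp add: inverse_eq_divide)
    qed
    then show ?thesis
      by fastforce
  qed
  ultimately show ?thesis
    by simp
qed

text \<open>The ratios \<open>t (Suc k) / t k\<close> may be arbitrarily small, so
  \<open>t (\<kappa> n)\<close> has no lower bound by a power of \<open>n\<close> valid at every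
  \<open>n\<close>. Divergence comes from counting: about \<open>t k powr (- c)\<close> indices have
  \<kappa>-value at most \<open>k\<close>, and each contributes at least \<open>t k powr s\<close>.
  The total is of order \<open>t k powr (s - c)\<close>, which is unbounded as \<open>t k\<close>
  tends to 0.\<close>

lemma null_sequence_slowed_down:
  fixes t :: "nat \<Rightarrow> real"
  assumes "antimono t" and pos: "\<And>k. 0 < t k" and lim: "t \<longlonglongrightarrow> 0" and s: "0 < s" "s < 1"
  obtains \<kappa> where "mono_on {1..} \<kappa>" "summable (\<lambda>n. t (\<kappa> n))"
    "\<not> (\<lambda>n. t (\<kappa> n) powr s) summable_on {1..}"
proof -
  \<comment> \<open>Any number strictly between \<open>s\<close> and 1 would do:
    \<open>c < 1\<close> makes \<open>real n powr (- 1 / c)\<close> summable, and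
    \<open>s < c\<close> makes \<open>t k powr (s - c)\<close> blow up.\<close>
  define c where "c = (1 + s) / 2"
  have c: "s < c" "c < 1" "0 < c"
    using s by (auto simp: c_def)
  \<comment> \<open>At \<open>n = 0\<close> the bound is \<open>0 powr _ = 0\<close>, which no
    positive \<open>t k\<close> meets, so the value there is unspecified; hence the restriction to
    \<open>n \<ge> 1\<close> below.\<close>
  define \<kappa> where "\<kappa> n = (LEAST k. t k \<le> real n powr (- 1 / c))" for n
  have \<kappa>_least: "\<kappa> n \<le> k" if "t k \<le> real n powr (- 1 / c)" for n k
    unfolding \<kappa>_def using that by (rule Least_le)
  have \<kappa>: "t (\<kappa> n) \<le> real n powr (- 1 / c)" if "n \<ge> 1" for n
  proof -
    have "eventually (\<lambda>k. t k < real n powr (- 1 / c)) sequentially"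
      using lim by (rule order_tendstoD) (use that in auto)
    then obtain k where "t k \<le> real n powr (- 1 / c)"
      by (metis eventually_sequentially less_imp_le order_refl)
    then show ?thesis
      unfolding \<kappa>_def by (rule LeastI)
  qed
  have mono: "mono_on {1..} \<kappa>"
  proof (rule mono_onI)
    fix m n :: nat assume *: "m \<in> {1..}" "n \<in> {1..}" "m \<le> n"
    then have "real n powr (- 1 / c) \<le> real m powr (- 1 / c)"
      using c by (intro powr_mono2') auto
    then show "\<kappa> m \<le> \<kappa> n"
      using * \<kappa>[of n] by (intro \<kappa>_least) auto
  qed
  have "summable (\<lambda>n. real n powr (- 1 / c))"
    using c by (subst summable_real_powr_iff) (simp add: field_simps)
  then have summable: "summable (\<lambda>n. t (\<kappa> n))"
    by (rule summable_comparison_test'[where N = 1]) (use \<kappa> in \<open>auto simp: abs_of_pos[OF pos]\<close>)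
  have "\<not> (\<lambda>n. t (\<kappa> n) powr s) summable_on {1..}"
  proof
    assume *: "(\<lambda>n. t (\<kappa> n) powr s) summable_on {1..}"
    define C where "C = infsum (\<lambda>n. t (\<kappa> n) powr s) {1..}"
    text \<open>The first \<open>\<lfloor>t k powr -c\<rfloor>\<close> indices are all sent to at most \<open>k\<close>.\<close>
    have bound: "t k powr (s - c) \<le> C + t k powr s" for k
    proof -
      define N where "N = nat \<lfloor>t k powr (- c)\<rfloor>"
      have N: "real N \<le> t k powr (- c)" "t k powr (- c) \<le> real N + 1"
        unfolding N_def by (simp, linarith)
      have le: "t k powr s \<le> t (\<kappa> n) powr s" if n: "n \<in> {1..N}" for n
      proof -
        \<comment> \<open>Raising \<open>n \<le> t k powr (- c)\<close> to the negative power
          \<open>- 1 / c\<close> reverses it into the condition that defines \<kappa>, so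
          \<open>k\<close> is a candidate for the least index.\<close>
        have "t k = (t k powr (- c)) powr (- 1 / c)"
          using pos[of k] c by (simp add: powr_powr)
        also have "\<dots> \<le> real n powr (- 1 / c)"
          using n N c by (intro powr_mono2') auto
        finally have "\<kappa> n \<le> k"
          by (rule \<kappa>_least)
        then show ?thesis
          using \<open>antimono t\<close> s pos[of k] by (intro powr_mono2) (auto simp: antimono_def)
      qed
      \<comment> \<open>Rounding down to \<open>N\<close> loses less than one term, which the
        summand \<open>t k powr s\<close> in the bound pays for.\<close>
      have "t k powr (s - c) = t k powr (- c) * t k powr s"
        by (simp flip: powr_add)
      also have "\<dots> \<le> (real N + 1) * t k powr s"
        using N by (intro mult_right_mono) auto
      also have "\<dots> = (\<Sum>n\<in>{1..N}. t k powr s) + t k powr s"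
        by (simp add: algebra_simps)
      also have "\<dots> \<le> (\<Sum>n\<in>{1..N}. t (\<kappa> n) powr s) + t k powr s"
        using le by (intro add_right_mono sum_mono)
      also have "(\<Sum>n\<in>{1..N}. t (\<kappa> n) powr s) \<le> C"
        unfolding C_def using * by (intro finite_sum_le_infsum) auto
      finally show ?thesis
        by simp
    qed
    \<comment> \<open>\<open>C + t 0 powr s\<close> dominates the right side of \<open>bound\<close>
      for all \<open>k\<close> at once; the maximum with 1 keeps \<open>K\<close> positive, so that
      the powers of \<open>K\<close> can be inverted.\<close>
    define K where "K = max 1 (C + t 0 powr s)"
    have "0 < K powr (1 / (s - c))"
      by (simp add: K_def)
    then have "eventually (\<lambda>k. t k < K powr (1 / (s - c))) sequentially"
      using lim by (intro order_tendstoD)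
    then obtain k where "t k < K powr (1 / (s - c))"
      by (auto simp: eventually_sequentially)
    then have "(K powr (1 / (s - c))) powr (s - c) < t k powr (s - c)"
      using c pos by (intro powr_less_mono2_neg) auto
    then have "K < t k powr (s - c)"
      using c by (simp add: powr_powr K_def)
    moreover have "t k powr s \<le> t 0 powr s"
      using \<open>antimono t\<close> s pos[of k] by (intro powr_mono2) (auto simp: antimono_def)
    ultimately show False
      using bound[of k] by (simp add: K_def)
  qed
  with mono summable that show thesis
    by blast
qed

theorem corollary4p2:
  fixes M :: "'a::metric_space measure" and T :: "'a \<Rightarrow> 'a"
  assumes "prob_space M" and "sets M = sets borel"
    and "separably_supported M"
    and "measure_preserving_map M T"
    and "\<forall>z. measure M {z} = 0"
  shows "\<not> (\<exists>s::real. 0 < s \<and> s < 1 \<and>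
           (\<forall>y. \<forall>\<rho> :: nat \<Rightarrow> real.
              (\<forall>n\<ge>1. 0 < \<rho> n) \<and> antimono_on {1..} \<rho> \<and>
              \<not> (\<lambda>n. measure M (cball y (\<rho> n)) powr s) summable_on {1..}
              \<longrightarrow> BC_sequence M T (\<lambda>n. cball y (\<rho> n))))"
proof (intro notI, elim exE conjE)
  interpret prob_space M by fact
  note sets = \<open>sets M = sets borel\<close>
  fix s :: real
  assume s: "0 < s" "s < 1"
    and BC: "\<forall>y. \<forall>\<rho> :: nat \<Rightarrow> real.
              (\<forall>n\<ge>1. 0 < \<rho> n) \<and> antimono_on {1..} \<rho> \<and>
              \<not> (\<lambda>n. measure M (cball y (\<rho> n)) powr s) summable_on {1..}
              \<longrightarrow> BC_sequence M T (\<lambda>n. cball y (\<rho> n))"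
  \<comment> \<open>Off the support small balls are null and their powers vanish, so the series
    could not be made to diverge with small radii.\<close>
  obtain y where y: "\<And>r. 0 < r \<Longrightarrow> 0 < measure M (ball y r)"
    using exists_support_point[OF assms(1-3)] by blast
  define t where "t k = measure M (cball y (1 / Suc k))" for k
  have "antimono t"
    unfolding antimono_def t_def
    by (intro allI impI finite_measure_mono subset_cball) (auto simp: sets frac_le)
  moreover have "0 < t k" for k
  proof -
    have "0 < measure M (ball y (1 / Suc k))"
      by (rule y) simp
    also have "\<dots> \<le> t k"
      unfolding t_def by (intro finite_measure_mono ball_subset_cball) (simp add: sets)
    finally show ?thesis .
  qed
  moreover have "t \<longlonglongrightarrow> 0"
    using measure_cball_tendsto_singleton[OF finite_measure_axioms sets, of y] assms(5)
    by (simp add: t_def[abs_def])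
  ultimately obtain \<kappa> where \<kappa>: "mono_on {1..} \<kappa>" "summable (\<lambda>n. t (\<kappa> n))"
    "\<not> (\<lambda>n. t (\<kappa> n) powr s) summable_on {1..}"
    using null_sequence_slowed_down s by metis
  define \<rho> where "\<rho> n = 1 / real (Suc (\<kappa> n))" for n
  have "antimono_on {1..} \<rho>"
    using \<kappa>(1) by (auto simp: monotone_on_def \<rho>_def intro!: frac_le)
  moreover have "\<forall>n\<ge>1. 0 < \<rho> n"
    by (simp add: \<rho>_def)
  moreover have t_\<kappa>: "t (\<kappa> n) = measure M (cball y (\<rho> n))" for n
    by (simp add: t_def \<rho>_def)
  ultimately have "BC_sequence M T (\<lambda>n. cball y (\<rho> n))"
    using BC \<kappa>(3) by simp
  then have full: "measure M (limsup (\<lambda>n. (T ^^ n) -` cball y (\<rho> n) \<inter> space M)) = 1"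
    by (simp add: BC_sequence_def)
  \<comment> \<open>By invariance the \<open>n\<close>-th preimage has measure
    \<open>t (\<kappa> n)\<close>, a summable sequence; this half of Borel-Cantelli needs no
    independence.\<close>
  have "limsup (\<lambda>n. (T ^^ n) -` cball y (\<rho> n) \<inter> space M) \<in> null_sets M"
  proof (rule borel_cantelli_limsup1)
    fix n
    have "T ^^ n \<in> measurable M M"
      and *: "measure M ((T ^^ n) -` cball y (\<rho> n) \<inter> space M) = t (\<kappa> n)" for n
      using measure_preserving_map_funpow[OF assms(4), of n]
      by (auto simp: measure_preserving_map_def sets t_\<kappa>)
    then show "(T ^^ n) -` cball y (\<rho> n) \<inter> space M \<in> sets M"
      by (intro measurable_sets) (auto simp: sets)
    show "emeasure M ((T ^^ n) -` cball y (\<rho> n) \<inter> space M) < \<infinity>"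
      by (simp add: less_top[symmetric])
    show "summable (\<lambda>n. measure M ((T ^^ n) -` cball y (\<rho> n) \<inter> space M))"
      using \<kappa>(2) by (simp add: *)
  qed
  with full show False
    by (simp add: measure_eq_0_null_sets)
qed

end
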